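(* Let $(X,E)$ and $(Y,F)$ be digraphs. Then $(X\times Y,c_{E\boxplus F})=(X\times Y,c_E\boxplus c_F)$; that is, the Alexandroff closure of the digraph cartesian product equals the inductive product closure of the Alexandroff closures of the two digraphs.
   Context: A (Čech) closure space $(X,c)$ is a set $X$ with a function $c:2^X\to 2^X$ such that $c(\varnothing)=\varnothing$, $A\subset c(A)$, and $c(A\cup B)=c(A)\cup c(B)$. A set $U$ is a neighborhood of $x$ if $x\notin c(X\setminus U)$. The inductive product closure on $X\times Y$ is $(c_X\boxplus c_Y)(A)=\{(x,y)\mid ((\{x\}\times V)\cup(U\times\{y\}))\cap A\neq\varnothing$ for all neighborhoods $U$ of $x$ and $V$ of $y\}$. A (simple) digraph $(X,E)$ is a set $X$ with a relation $E\subset X\times X$ disjoint from the diagonal $\Delta$; $\overline E=E\cup\Delta$. Sets of vertices and edges may have arbitrary cardinality. The associated closure is $c_E(A)=\{y\in X\mid\exists x\in A,\ x\overline Ey\}$. The digraph cartesian product of $(X,E)$ and $(Y,F)$ is the digraph $(X\times Y,E\boxplus F)$ with $(x,y)(E\boxplus F)(x',y')$ if and only if either $x=x'$ and $yFy'$, or $xEx'$ and $y=y'$. *)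

theory Defs
  imports "HOL-Library.FuncSet" "Graph_Theory.Pair_Digraph"
begin

section \<open>Cech closure spaces\<close>

record 'a pre_closure_space =
  points :: "'a set"
  cl :: "'a set \<Rightarrow> 'a set"

text \<open>
  The operator of a space on \<open>X\<close> is a function on the subsets of \<open>X\<close>. Requiring it to be
  extensional (\<open>undefined\<close> outside \<open>Pow X\<close>) makes equality of records the same as equality of
  closure spaces.
\<close>
locale closure_space =
  fixes S :: "'a pre_closure_space" (structure)
  assumes cl_funcset: "cl S \<in> Pow (points S) \<rightarrow>\<^sub>E Pow (points S)"
    and cl_empty: "cl S {} = {}"
    and cl_subset: "A \<subseteq> points S \<Longrightarrow> A \<subseteq> cl S A"
    and cl_Un: "\<lbrakk>A \<subseteq> points S; B \<subseteq> points S\<rbrakk> \<Longrightarrow> cl S (A \<union> B) = cl S A \<union> cl S B"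

definition nbhds :: "'a pre_closure_space \<Rightarrow> 'a \<Rightarrow> 'a set set" where
  "nbhds S x = {U. U \<subseteq> points S \<and> x \<notin> cl S (points S - U)}"

definition inductive_product ::
  "'a pre_closure_space \<Rightarrow> 'b pre_closure_space \<Rightarrow> ('a \<times> 'b) pre_closure_space" where
  "inductive_product S T =
    \<lparr> points = points S \<times> points T,
      cl = (\<lambda>A\<in>Pow (points S \<times> points T).
        {(x, y) \<in> points S \<times> points T.
          \<forall>U\<in>nbhds S x. \<forall>V\<in>nbhds T y. (({x} \<times> V) \<union> (U \<times> {y})) \<inter> A \<noteq> {}}) \<rparr>"

section \<open>Digraphs\<close>

text \<open>
  A simple digraph with vertex and edge sets of arbitrary cardinality is a
  \<^const>\<open>pair_loopfree_digraph\<close>; the library's \<^const>\<open>pair_digraph\<close> is in addition finite.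
\<close>

definition digraph_closure :: "'a pair_pre_digraph \<Rightarrow> 'a pre_closure_space" where
  "digraph_closure G =
    \<lparr> points = pverts G,
      cl = (\<lambda>A\<in>Pow (pverts G).
        {y \<in> pverts G. \<exists>x\<in>A. (x, y) \<in> parcs G \<union> Id_on (pverts G)}) \<rparr>"

definition cartesian_product ::
  "'a pair_pre_digraph \<Rightarrow> 'b pair_pre_digraph \<Rightarrow> ('a \<times> 'b) pair_pre_digraph" where
  "cartesian_product G H =
    \<lparr> pverts = pverts G \<times> pverts H,
      parcs = {((x, y), (x', y')) \<in> (pverts G \<times> pverts H) \<times> (pverts G \<times> pverts H).
        (x = x' \<and> (y, y') \<in> parcs H) \<or> ((x, x') \<in> parcs G \<and> y = y')} \<rparr>"

section \<open>Well-definedness\<close>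

lemma pair_loopfree_digraph_cartesian_product:
  assumes "pair_loopfree_digraph G" "pair_loopfree_digraph H"
  shows "pair_loopfree_digraph (cartesian_product G H)"
proof -
  have "(x, x) \<notin> parcs G" for x
    using pair_loopfree_digraph.pair_no_loops[OF assms(1), of "(x, x)"] by auto
  moreover have "(y, y) \<notin> parcs H" for y
    using pair_loopfree_digraph.pair_no_loops[OF assms(2), of "(y, y)"] by auto
  ultimately show ?thesis
    by unfold_locales (auto simp: cartesian_product_def)
qed

lemma closure_space_digraph_closure: "closure_space (digraph_closure G)"
  by unfold_locales (auto simp: digraph_closure_def)

lemma (in closure_space) cl_mono:
  assumes "A \<subseteq> B" "B \<subseteq> points S"
  shows "cl S A \<subseteq> cl S B"
  using cl_Un[of A B] assms by (auto simp: Un_absorb1)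

lemma (in closure_space) nbhds_Int:
  assumes "U \<in> nbhds S x" "U' \<in> nbhds S x"
  shows "U \<inter> U' \<in> nbhds S x"
  using assms cl_Un[of "points S - U" "points S - U'"] by (auto simp: nbhds_def Diff_Int)

lemma (in closure_space) nbhds_point:
  assumes "U \<in> nbhds S x" "x \<in> points S"
  shows "x \<in> U"
  using assms cl_subset[of "points S - U"] by (auto simp: nbhds_def)

lemma closure_space_inductive_product:
  assumes "closure_space S" "closure_space T"
  shows "closure_space (inductive_product S T)"
proof
  interpret S: closure_space S by fact
  interpret T: closure_space T by fact
  let ?P = "inductive_product S T"
  show "cl ?P \<in> Pow (points ?P) \<rightarrow>\<^sub>E Pow (points ?P)"
    by (auto simp: inductive_product_def)
  have "points S \<in> nbhds S x" "points T \<in> nbhds T y" for x y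
    by (auto simp: nbhds_def S.cl_empty T.cl_empty)
  then show "cl ?P {} = {}"
    by (auto simp: inductive_product_def)
  show "A \<subseteq> cl ?P A" if "A \<subseteq> points ?P" for A
    using that S.nbhds_point T.nbhds_point by (fastforce simp: inductive_product_def)
  fix A B
  assume AB: "A \<subseteq> points ?P" "B \<subseteq> points ?P"
  show "cl ?P (A \<union> B) = cl ?P A \<union> cl ?P B"
  proof
    show "cl ?P A \<union> cl ?P B \<subseteq> cl ?P (A \<union> B)"
      using AB by (auto simp: inductive_product_def) blast+
    show "cl ?P (A \<union> B) \<subseteq> cl ?P A \<union> cl ?P B"
    proof
      fix p assume p: "p \<in> cl ?P (A \<union> B)"
      obtain x y where xy: "p = (x, y)" by force
      have xyP: "x \<in> points S" "y \<in> points T"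
        and *: "\<And>U V. U \<in> nbhds S x \<Longrightarrow> V \<in> nbhds T y \<Longrightarrow>
          (({x} \<times> V) \<union> (U \<times> {y})) \<inter> (A \<union> B) \<noteq> {}"
        using p AB xy by (auto simp: inductive_product_def)
      show "p \<in> cl ?P A \<union> cl ?P B"
      proof (rule ccontr)
        assume "p \<notin> cl ?P A \<union> cl ?P B"
        then have "p \<notin> cl ?P A" "p \<notin> cl ?P B"
          by auto
        from this(1) obtain U V where UV: "U \<in> nbhds S x" "V \<in> nbhds T y"
          "(({x} \<times> V) \<union> (U \<times> {y})) \<inter> A = {}"
          using AB xyP unfolding xy by (auto simp: inductive_product_def)
        from \<open>p \<notin> cl ?P B\<close> obtain U' V' where UV': "U' \<in> nbhds S x" "V' \<in> nbhds T y"
          "(({x} \<times> V') \<union> (U' \<times> {y})) \<inter> B = {}"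
          using AB xyP unfolding xy by (auto simp: inductive_product_def)
        have "(({x} \<times> (V \<inter> V')) \<union> ((U \<inter> U') \<times> {y})) \<inter> (A \<union> B) = {}"
          using UV(3) UV'(3) by blast
        with *[OF S.nbhds_Int[OF UV(1) UV'(1)] T.nbhds_Int[OF UV(2) UV'(2)]] show False
          by simp
      qed
    qed
  qed
qed

end

(* In the closure of a digraph every vertex x has a least neighborhood, the set of x and its
   in-neighbors. The condition defining the inductive product is monotone in U and V, so it
   need only be tested on least neighborhoods, where it says that A contains (x, y) or one of
   its in-neighbors in the cartesian product. *)
theory Submission
  imports Defs
begin

text \<open>The restriction to \<open>pverts G\<close> keeps this set inside the space, as
  \<open>nbhds\<close> requires of a neighborhood.\<close>

definition least_nbhd :: "'a pair_pre_digraph \<Rightarrow> 'a \<Rightarrow> 'a set" where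
  "least_nbhd G x = {z \<in> pverts G. z = x \<or> (z, x) \<in> parcs G}"

text \<open>The point \<open>x\<close> avoids the closure of the complement of \<open>U\<close>
  exactly when no vertex outside \<open>U\<close> is \<open>x\<close> or has an edge into
  \<open>x\<close>.\<close>

lemma nbhds_digraph_closure:
  assumes "x \<in> pverts G"
  shows "nbhds (digraph_closure G) x = {U. least_nbhd G x \<subseteq> U \<and> U \<subseteq> pverts G}"
  using assms by (auto simp: nbhds_def digraph_closure_def least_nbhd_def)

lemma cl_inductive_product_digraph_closure:
  assumes "A \<subseteq> pverts G \<times> pverts H"
  shows "cl (inductive_product (digraph_closure G) (digraph_closure H)) A =
    {(x, y) \<in> pverts G \<times> pverts H.
      ({x} \<times> least_nbhd H y \<union> least_nbhd G x \<times> {y}) \<inter> A \<noteq> {}}"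
proof -
  have points: "points (digraph_closure G) = pverts G" "points (digraph_closure H) = pverts H"
    by (simp_all add: digraph_closure_def)
  have "(\<forall>U\<in>nbhds (digraph_closure G) x. \<forall>V\<in>nbhds (digraph_closure H) y.
      ({x} \<times> V \<union> U \<times> {y}) \<inter> A \<noteq> {}) \<longleftrightarrow>
    ({x} \<times> least_nbhd H y \<union> least_nbhd G x \<times> {y}) \<inter> A \<noteq> {}" (is "?L \<longleftrightarrow> ?R")
    if "x \<in> pverts G" "y \<in> pverts H" for x y
  proof
    have "least_nbhd G x \<in> nbhds (digraph_closure G) x"
      "least_nbhd H y \<in> nbhds (digraph_closure H) y"
      using that by (auto simp: nbhds_digraph_closure least_nbhd_def)
    then show "?L \<Longrightarrow> ?R" by blast
    show "?R \<Longrightarrow> ?L"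
      \<comment> \<open>A point of \<open>A\<close> in the cross of the least neighborhoods lies in
        the cross of any larger \<open>U\<close> and \<open>V\<close>.\<close>
      unfolding nbhds_digraph_closure[OF that(1)] nbhds_digraph_closure[OF that(2)] by blast
  qed
  then show ?thesis
    using assms by (auto simp: inductive_product_def points)
qed

text \<open>An edge of the product changes one coordinate only, so an edge into
  \<open>(x, y)\<close> starts on one arm of the cross; the diagonal contributes
  \<open>(x, y)\<close> itself, which lies on both arms.\<close>

lemma cl_digraph_closure_cartesian_product:
  assumes "A \<subseteq> pverts G \<times> pverts H"
  shows "cl (digraph_closure (cartesian_product G H)) A =
    {(x, y) \<in> pverts G \<times> pverts H.
      ({x} \<times> least_nbhd H y \<union> least_nbhd G x \<times> {y}) \<inter> A \<noteq> {}}"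
  using assms unfolding digraph_closure_def cartesian_product_def least_nbhd_def by fastforce

theorem proposition2p8:
  fixes G :: "'a pair_pre_digraph" and H :: "'b pair_pre_digraph"
  assumes "pair_loopfree_digraph G" and "pair_loopfree_digraph H"
  shows "digraph_closure (cartesian_product G H) =
    inductive_product (digraph_closure G) (digraph_closure H)"
    (is "?L = ?R")
proof (rule pre_closure_space.equality)
  show "points ?L = points ?R"
    by (simp add: digraph_closure_def cartesian_product_def inductive_product_def)
  show "cl ?L = cl ?R"
  proof
    fix A :: "('a \<times> 'b) set"
    show "cl ?L A = cl ?R A"
    proof (cases "A \<subseteq> pverts G \<times> pverts H")
      case True
      then show ?thesis
        by (simp only: cl_inductive_product_digraph_closure cl_digraph_closure_cartesian_product)
    next
      case False
      \<comment> \<open>Outside the power set of the product both operators are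
        \<open>undefined\<close>, being restricted to the same domain.\<close>
      then show ?thesis
        by (simp add: digraph_closure_def cartesian_product_def inductive_product_def)
    qed
  qed
qed simp

end
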